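(* There exists a dense subgroup $X$ of $\mathbb{Z}^\omega$ such that $|X|=\mathfrak{b}$ and $X$, with the subspace topology, is a $\lambda$-set.
   Context: The result is a theorem of ZFC. $\mathbb{Z}$ denotes the integers with the discrete topology and addition; $\mathbb{Z}^\omega$ carries the product topology and coordinatewise addition, so it is a topological group. For $f,g\in\omega^\omega$, write $f\leq^\ast g$ if $f(n)\leq g(n)$ for all but finitely many $n\in\omega$. A set $S\subseteq\omega^\omega$ is bounded if there exists $g\in\omega^\omega$ such that $f\leq^\ast g$ for every $f\in S$, and unbounded otherwise. The cardinal $\mathfrak{b}$ is the minimum of $|S|$ over all unbounded $S\subseteq\omega^\omega$. A (separable metrizable) space $X$ is a $\lambda$-set if every countable (i.e., at most countable) subset of $X$ is a $G_\delta$-subset of $X$. *)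

theory Defs
  imports "HOL-Analysis.Analysis" "HOL-Algebra.Product_Groups"
begin

unbundle cardinal_syntax

definition le_star :: "(nat \<Rightarrow> nat) \<Rightarrow> (nat \<Rightarrow> nat) \<Rightarrow> bool" (infix "\<le>\<^sup>*" 50)
  where "f \<le>\<^sup>* g \<longleftrightarrow> finite {n. \<not> f n \<le> g n}"

definition bounded_star :: "(nat \<Rightarrow> nat) set \<Rightarrow> bool"
  where "bounded_star S \<longleftrightarrow> (\<exists>g. \<forall>f\<in>S. f \<le>\<^sup>* g)"

(* Cardinals are represented, as in the library, by cardinal well-orders, and a minimum of
   cardinals is determined only up to =o. The choice operator picks one representative;
   the lemmas below show that the minimum exists and characterise it. *)
definition bounding_number :: "(nat \<Rightarrow> nat) rel" ("\<bb>")
  where "\<bb> = (SOME r. (\<exists>S. \<not> bounded_star S \<and> r = |S| ) \<and>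
                      (\<forall>S. \<not> bounded_star S \<longrightarrow> r \<le>o |S| ))"

lemma not_bounded_star_UNIV: "\<not> bounded_star UNIV"
proof
  assume "bounded_star UNIV"
  then obtain g where g: "\<And>f. f \<le>\<^sup>* g"
    by (auto simp: bounded_star_def)
  have "{n. \<not> Suc (g n) \<le> g n} = UNIV"
    by auto
  with g[of "\<lambda>n. Suc (g n)"] show False
    by (simp add: le_star_def)
qed

lemma bounding_number_props:
  "(\<exists>S. \<not> bounded_star S \<and> \<bb> = |S| ) \<and> (\<forall>S. \<not> bounded_star S \<longrightarrow> \<bb> \<le>o |S| )"
proof -
  let ?R = "card_of ` {S. \<not> bounded_star S}"
  have "?R \<noteq> {}"
    using not_bounded_star_UNIV by blast
  moreover have "\<forall>r\<in>?R. Card_order r"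
    by (auto intro: card_of_Card_order)
  ultimately obtain r where "r \<in> ?R" "\<forall>r'\<in>?R. r \<le>o r'"
    using exists_minim_Card_order[of ?R] by blast
  then have "(\<exists>S. \<not> bounded_star S \<and> r = |S| ) \<and> (\<forall>S. \<not> bounded_star S \<longrightarrow> r \<le>o |S| )"
    by blast
  then show ?thesis
    unfolding bounding_number_def by (rule someI)
qed

lemma bounding_number_attained: "\<exists>S. \<not> bounded_star S \<and> \<bb> = |S|"
  using bounding_number_props by blast

lemma bounding_number_le: "\<not> bounded_star S \<Longrightarrow> \<bb> \<le>o |S|"
  using bounding_number_props by blast

definition lambda_set :: "'a topology \<Rightarrow> bool"
  where "lambda_set T \<longleftrightarrow>
    metrizable_space T \<and> separable_space T \<and>
    (\<forall>C. C \<subseteq> topspace T \<and> countable C \<longrightarrow> gdelta_in T C)"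

abbreviation Z_omega_group :: "(nat \<Rightarrow> int) monoid"
  where "Z_omega_group \<equiv> product_group UNIV (\<lambda>_. integer_group)"

abbreviation Z_omega_topology :: "(nat \<Rightarrow> int) topology"
  where "Z_omega_topology \<equiv> product_topology (\<lambda>_. discrete_topology UNIV) UNIV"

end

theory Submission
  imports Defs "HOL-Algebra.Free_Abelian_Groups"
begin

text \<open>
  Well-order an unbounded family \<open>S\<close> of size \<open>\<bb>\<close> so that every proper initial segment has size less
  than \<open>\<bb>\<close>. As such segments are bounded, recursion along the well-order replaces each \<open>s \<in> S\<close> by
  some \<open>f\<^sub>s \<ge> s\<close> that eventually dominates every constant multiple of every earlier \<open>f\<^sub>t\<close>
  (\<open>rapidly_increasing_above\<close>). Let \<open>X\<close> be the group of all integer sequences that are eventually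
  equal to an integer combination of finitely many of the \<open>f\<^sub>s\<close>. It contains all sequences of finite
  support, so it is dense, and it has size \<open>\<bb>\<close>.

  For \<open>s \<in> S\<close> let \<open>X\<^sub>s\<close> be the subgroup defined in the same way from the generators strictly below \<open>s\<close>.
  The greatest generator that occurs in an element determines its growth. Hence elements of \<open>X\<^sub>s\<close> are
  eventually at most \<open>f\<^sub>s / 3\<close> in absolute value, and elements of \<open>X - X\<^sub>s\<close> are eventually at least
  \<open>2 f\<^sub>s / 3\<close> (\<open>eventual_span_underS_small\<close>, \<open>eventual_span_not_underS_large\<close>).

  Let \<open>C = {c\<^sub>0, c\<^sub>1, \<dots>}\<close> be a countable subset of \<open>X\<close>. Countably many generators occur in its elements,
  and they are not cofinal in \<open>S\<close>: otherwise a bound of these countably many functions would be a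
  bound of \<open>S\<close>. So \<open>C \<subseteq> X\<^sub>s\<close> for some \<open>s\<close>. To see that \<open>C\<close> is a \<open>G\<^sub>\<delta>\<close> subset of \<open>X\<close>, it suffices to find one
  function \<open>h\<close> such that every \<open>x \<in> X - C\<close> differs from \<open>c\<^sub>n\<close> at a place \<open>\<le> h n\<close>, for all but finitely
  many \<open>n\<close> (\<open>gdelta_in_if_first_differences_bounded\<close>). For \<open>x \<in> X\<^sub>s - C\<close> such an \<open>h\<close> exists because \<open>X\<^sub>s\<close> has
  size less than \<open>\<bb>\<close>. For \<open>x \<in> X - X\<^sub>s\<close> the gap between \<open>f\<^sub>s / 3\<close> and \<open>2 f\<^sub>s / 3\<close> separates \<open>x\<close> from \<open>c\<^sub>n\<close> at every
  place beyond both a constant \<open>m\<close> that depends on \<open>x\<close> and a \<open>k\<^sub>n\<close> that depends on \<open>c\<^sub>n\<close>; so \<open>h n = max k\<^sub>n n\<close>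
  works for all \<open>n \<ge> m\<close>.
\<close>

section \<open>Families of size less than \<open>\<bb>\<close>\<close>

lemma le_star_eventually: "f \<le>\<^sup>* g \<longleftrightarrow> (\<forall>\<^sub>F n in sequentially. f n \<le> g n)"
  by (simp add: le_star_def eventually_cofinite flip: cofinite_eq_sequentially)

text \<open>
  The diagonal argument: a function whose value at \<open>n\<close> is at least that of every member with index up
  to \<open>n\<close> dominates each member from its index on.
\<close>
lemma bounded_star_if_countable:
  assumes "countable A"
  shows "bounded_star A"
proof (cases "A = {}")
  case True
  then show ?thesis by (simp add: bounded_star_def)
next
  case False
  define g where "g n = (\<Sum>k\<le>n. from_nat_into A k n)" for n
  have "from_nat_into A k \<le>\<^sup>* g" for k
  proof -
    have "from_nat_into A k n \<le> g n" if "n \<ge> k" for n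
      unfolding g_def using that by (intro member_le_sum) auto
    then show ?thesis
      unfolding le_star_eventually eventually_sequentially by blast
  qed
  moreover have "A = range (from_nat_into A)"
    using False assms by (simp add: range_from_nat_into)
  ultimately show ?thesis
    unfolding bounded_star_def by (metis imageE)
qed

lemma bounded_star_if_card_less:
  assumes "|A| <o \<bb>"
  shows "bounded_star A"
  using assms bounding_number_le not_ordLess_ordLeq by blast

section \<open>Rapidly increasing families\<close>

text \<open>
  Domination of all constant multiples makes the largest generator in an integer combination
  outweigh all the others together. Positivity makes the thresholds \<open>f s / 3\<close> and \<open>2 * f s / 3\<close>
  distinct at every place.
\<close>
locale rapidly_increasing =
  fixes r :: "'i rel" and f :: "'i \<Rightarrow> nat \<Rightarrow> nat"
  assumes wo: "Well_order r"
    and positive: "s \<in> Field r \<Longrightarrow> 1 \<le> f s n"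
    and multiples: "t \<in> underS r s \<Longrightarrow> \<forall>\<^sub>F n in sequentially. k * f t n \<le> f s n"

text \<open>
  At stage \<open>s\<close> of the recursion fewer than \<open>\<bb>\<close> functions have to be dominated, because in the cardinal
  order of \<open>S\<close> the predecessors of \<open>s\<close> form a set of smaller size.
\<close>
lemma rapidly_increasing_above:
  fixes S :: "(nat \<Rightarrow> nat) set"
  assumes S: "|S| = \<bb>"
  obtains f where "rapidly_increasing |S| f" "\<And>s n. s \<in> S \<Longrightarrow> s n \<le> f s n"
proof -
  have wo: "Well_order |S|"
    by (rule card_of_Well_order)
  define P where "P f s g \<longleftrightarrow> (\<forall>n. 1 \<le> g n \<and> s n \<le> g n) \<and>
      (\<forall>t\<in>underS |S| s. \<forall>k. \<forall>\<^sub>F n in sequentially. k * f t n \<le> g n)"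
    for f :: "(nat \<Rightarrow> nat) \<Rightarrow> nat \<Rightarrow> nat" and s g
  have "\<exists>f. \<forall>s. P f s (f s)"
  proof (rule dependent_wf_choice)
    show "wf ( |S| - Id)"
      using wo by (simp add: well_order_on_def)
    show "P f s g = P f' s g" if "\<And>t. (t, s) \<in> |S| - Id \<Longrightarrow> f t = f' t" for f f' s g
      using that by (auto simp: P_def underS_def)
    show "\<exists>g. P f s g" for f s
    proof -
      \<comment> \<open>A bound of \<open>n * f t n\<close> dominates every constant multiple of \<open>f t\<close>.\<close>
      let ?A = "(\<lambda>t n. n * f t n) ` underS |S| s"
      have "bounded_star ?A"
      proof (cases "s \<in> S")
        case True
        then have "|underS |S| s| <o |S|"
          by (intro card_of_underS) (auto simp: card_of_Card_order Field_card_of)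
        then have "|?A| <o \<bb>"
          unfolding S[symmetric] using card_of_image ordLeq_ordLess_trans by blast
        then show ?thesis by (rule bounded_star_if_card_less)
      next
        case False
        then have "underS |S| s = {}"
          by (auto simp: underS_def dest: FieldI2)
        then show ?thesis by (simp add: bounded_star_def)
      qed
      then obtain g where g: "\<And>t. t \<in> underS |S| s \<Longrightarrow> (\<lambda>n. n * f t n) \<le>\<^sup>* g"
        unfolding bounded_star_def by blast
      have "\<forall>\<^sub>F n in sequentially. k * f t n \<le> g n + s n + 1" if "t \<in> underS |S| s" for t k
      proof -
        have "\<forall>\<^sub>F n in sequentially. n * f t n \<le> g n"
          using g[OF that] by (simp add: le_star_eventually)
        with eventually_ge_at_top[of k] show ?thesis
          by eventually_elim (meson le_trans mult_le_mono1 trans_le_add1)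
      qed
      then have "P f s (\<lambda>n. g n + s n + 1)"
        by (simp add: P_def)
      then show ?thesis by blast
    qed
  qed
  then obtain f where f: "\<And>s. P f s (f s)"
    by blast
  show thesis
  proof
    show "rapidly_increasing |S| f"
      using f wo unfolding P_def by unfold_locales blast+
    show "\<And>s n. s \<in> S \<Longrightarrow> s n \<le> f s n"
      using f by (simp add: P_def)
  qed
qed

section \<open>The group of sequences eventually equal to integer combinations\<close>

text \<open>
  Equality is required only eventually. This makes the group contain every sequence of finite
  support, hence be dense, without any change in the growth of its elements.
\<close>
definition eventual_span :: "('i \<Rightarrow> nat \<Rightarrow> nat) \<Rightarrow> 'i set \<Rightarrow> (nat \<Rightarrow> int) set"
  where "eventual_span f A = {x. \<exists>F c. finite F \<and> F \<subseteq> A \<and>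
    (\<forall>\<^sub>F n in sequentially. x n = (\<Sum>t\<in>F. c t * int (f t n)))}"

lemma eventual_span_mono: "A \<subseteq> B \<Longrightarrow> eventual_span f A \<subseteq> eventual_span f B"
  unfolding eventual_span_def by blast

lemma generator_in_eventual_span:
  assumes "s \<in> A"
  shows "(\<lambda>n. int (f s n)) \<in> eventual_span f A"
proof -
  have "\<forall>\<^sub>F n in sequentially. int (f s n) = (\<Sum>t\<in>{s}. 1 * int (f t n))"
    by simp
  then show ?thesis
    unfolding eventual_span_def using assms
    by (intro CollectI exI[of _ "{s}"] exI[of _ "\<lambda>_. 1"]) auto
qed

lemma eventually_zero_in_eventual_span:
  assumes "\<forall>\<^sub>F n in sequentially. x n = 0"
  shows "x \<in> eventual_span f A"
  using assms unfolding eventual_span_def by (intro CollectI exI[of _ "{}"]) auto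

lemma eventual_span_add:
  assumes "x \<in> eventual_span f A" "y \<in> eventual_span f A"
  shows "(\<lambda>n. x n + y n) \<in> eventual_span f A"
proof -
  obtain F c G d where F: "finite F" "F \<subseteq> A" "finite G" "G \<subseteq> A"
    and x: "\<forall>\<^sub>F n in sequentially. x n = (\<Sum>t\<in>F. c t * int (f t n))"
    and y: "\<forall>\<^sub>F n in sequentially. y n = (\<Sum>t\<in>G. d t * int (f t n))"
    using assms unfolding eventual_span_def by blast
  define e where "e t = (if t \<in> F then c t else 0) + (if t \<in> G then d t else 0)" for t
  have sum_e: "(\<Sum>t\<in>F \<union> G. e t * int (f t n))
      = (\<Sum>t\<in>F. c t * int (f t n)) + (\<Sum>t\<in>G. d t * int (f t n))" for n
  proof -
    have "(\<Sum>t\<in>F \<union> G. e t * int (f t n))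
        = (\<Sum>t\<in>F \<union> G. if t \<in> F then c t * int (f t n) else 0)
        + (\<Sum>t\<in>F \<union> G. if t \<in> G then d t * int (f t n) else 0)"
      unfolding sum.distrib[symmetric] by (intro sum.cong) (auto simp: e_def algebra_simps)
    also have "(\<Sum>t\<in>F \<union> G. if t \<in> F then c t * int (f t n) else 0) = (\<Sum>t\<in>F. c t * int (f t n))"
      using F by (intro sum.mono_neutral_cong_right) auto
    also have "(\<Sum>t\<in>F \<union> G. if t \<in> G then d t * int (f t n) else 0) = (\<Sum>t\<in>G. d t * int (f t n))"
      using F by (intro sum.mono_neutral_cong_right) auto
    finally show ?thesis .
  qed
  have "\<forall>\<^sub>F n in sequentially. x n + y n = (\<Sum>t\<in>F \<union> G. e t * int (f t n))"
    using x y by eventually_elim (simp add: sum_e)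
  then show ?thesis
    unfolding eventual_span_def using F by (intro CollectI exI[of _ "F \<union> G"] exI[of _ e]) auto
qed

lemma eventual_span_uminus:
  assumes "x \<in> eventual_span f A"
  shows "(\<lambda>n. - x n) \<in> eventual_span f A"
proof -
  obtain F c where F: "finite F" "F \<subseteq> A"
    and x: "\<forall>\<^sub>F n in sequentially. x n = (\<Sum>t\<in>F. c t * int (f t n))"
    using assms unfolding eventual_span_def by blast
  have "\<forall>\<^sub>F n in sequentially. - x n = (\<Sum>t\<in>F. - c t * int (f t n))"
    using x by eventually_elim (simp add: sum_negf)
  then show ?thesis
    unfolding eventual_span_def using F by (intro CollectI exI[of _ F] exI[of _ "\<lambda>t. - c t"]) auto
qed

lemma subgroup_eventual_span: "subgroup (eventual_span f A) Z_omega_group"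
proof -
  have grp: "group Z_omega_group"
    by simp
  have inv: "inv\<^bsub>integer_group\<^esub> a = - a" for a
    by (rule group.inv_equality[OF group_integer_group]) (auto simp: integer_group_def)
  show ?thesis
  proof (rule group.subgroupI[OF grp])
    show "eventual_span f A \<subseteq> carrier Z_omega_group"
      by (auto simp: integer_group_def PiE_UNIV_domain)
    show "eventual_span f A \<noteq> {}"
      using eventually_zero_in_eventual_span[of "\<lambda>_. 0"] by fastforce
    show "inv\<^bsub>Z_omega_group\<^esub> x \<in> eventual_span f A" if "x \<in> eventual_span f A" for x
    proof -
      have "inv\<^bsub>Z_omega_group\<^esub> x = (\<lambda>n. - x n)"
        by (subst inv_product_group) (simp_all add: inv fun_eq_iff)
      then show ?thesis
        using eventual_span_uminus[OF that] by simp
    qed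
    show "x \<otimes>\<^bsub>Z_omega_group\<^esub> y \<in> eventual_span f A"
      if "x \<in> eventual_span f A" "y \<in> eventual_span f A" for x y
      using eventual_span_add[OF that] by (simp add: integer_group_def restrict_def)
  qed
qed

text \<open>
  A basic open set restricts finitely many coordinates, so it contains a sequence of finite support.
\<close>
lemma dense_eventual_span:
  "Z_omega_topology closure_of eventual_span f A = topspace Z_omega_topology"
proof -
  have "\<exists>y. y \<in> eventual_span f A \<and> y \<in> U" if U: "openin Z_omega_topology U" "x \<in> U" for x U
  proof -
    obtain V where V: "finite {i. V i \<noteq> UNIV}" "x \<in> Pi\<^sub>E UNIV V" "Pi\<^sub>E UNIV V \<subseteq> U"
      using U unfolding openin_product_topology_alt by auto
    define y where "y i = (if V i = UNIV then 0 else x i)" for i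
    have "\<forall>\<^sub>F i in sequentially. V i = UNIV"
      using V(1) by (simp add: eventually_cofinite flip: cofinite_eq_sequentially)
    then have "\<forall>\<^sub>F i in sequentially. y i = 0"
      by eventually_elim (simp add: y_def)
    moreover have "y \<in> U"
      using V(2,3) by (intro subsetD[OF V(3)]) (auto simp: y_def PiE_UNIV_domain)
    ultimately show ?thesis
      using eventually_zero_in_eventual_span by blast
  qed
  then show ?thesis
    by (auto simp: in_closure_of closure_of_subset_topspace set_eq_iff)
qed

text \<open>
  For counting: an element is determined by a list of generators with coefficients and by the finite
  initial part on which it may deviate from the combination.
\<close>
lemma eventual_span_subset_image_lists:
  "eventual_span f A \<subseteq>
     (\<lambda>(l, q) n. if n < length q then q ! n else \<Sum>(t, m)\<leftarrow>l. m * int (f t n))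
       ` (lists (A \<times> UNIV) \<times> UNIV)"
proof
  fix x assume "x \<in> eventual_span f A"
  then obtain F c N where F: "finite F" "F \<subseteq> A"
    and x: "\<And>n. n \<ge> N \<Longrightarrow> x n = (\<Sum>t\<in>F. c t * int (f t n))"
    unfolding eventual_span_def eventually_sequentially by blast
  obtain l where l: "distinct l" "set l = F"
    using F finite_distinct_list by blast
  have "(\<Sum>(t, m)\<leftarrow>map (\<lambda>t. (t, c t)) l. m * int (f t n)) = (\<Sum>t\<in>F. c t * int (f t n))" for n
    using l by (simp add: o_def sum_list_distinct_conv_sum_set)
  then have "x = (\<lambda>(l, q) n. if n < length q then q ! n else \<Sum>(t, m)\<leftarrow>l. m * int (f t n))
      (map (\<lambda>t. (t, c t)) l, map x [0..<N])"
    using x by auto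
  moreover have "map (\<lambda>t. (t, c t)) l \<in> lists (A \<times> UNIV)"
    using l F by auto
  ultimately show "x \<in> (\<lambda>(l, q) n. if n < length q then q ! n
      else \<Sum>(t, m)\<leftarrow>l. m * int (f t n)) ` (lists (A \<times> UNIV) \<times> UNIV)"
    by blast
qed

lemma countable_eventual_span:
  assumes "countable A"
  shows "countable (eventual_span f A)"
  by (rule countable_subset[OF eventual_span_subset_image_lists])
    (use assms in \<open>intro countable_image countable_SIGMA countable_lists; auto\<close>)

lemma card_eventual_span:
  assumes "infinite A"
  shows "|eventual_span f A| \<le>o |A|"
proof -
  have countable_le: "|B| \<le>o |A|" if "countable B" for B :: "'c set"
  proof -
    have "|B| \<le>o |UNIV :: nat set|"
      using that card_of_ordLeq[of B "UNIV :: nat set"] unfolding countable_def by auto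
    also have "|UNIV :: nat set| \<le>o |A|"
      using assms by (simp add: infinite_iff_card_of_nat)
    finally show ?thesis .
  qed
  have "|A \<times> (UNIV :: int set)| \<le>o |A|"
    by (rule card_of_Times_ordLeq_infinite[OF assms]) (simp_all add: countable_le)
  then have "|lists (A \<times> (UNIV :: int set))| \<le>o |lists A|"
    by (rule card_of_lists_mono)
  also have "|lists A| =o |A|"
    by (rule card_of_lists_infinite[OF assms])
  finally have "|lists (A \<times> (UNIV :: int set)) \<times> (UNIV :: int list set)| \<le>o |A|"
    by (rule card_of_Times_ordLeq_infinite[OF assms]) (simp add: countable_le)
  then show ?thesis
    by (rule ordLeq_transitive[OF ordLeq_transitive[OF
          card_of_mono1[OF eventual_span_subset_image_lists] card_of_image]])
qed

section \<open>Growth of the elements of the group\<close>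

context rapidly_increasing
begin

lemma underS_trans: "t \<in> underS r s \<Longrightarrow> s \<in> underS r u \<Longrightarrow> t \<in> underS r u"
  using wo unfolding order_on_defs underS_def by (auto dest: transD antisymD)

lemma underS_cases: "\<lbrakk>s \<in> Field r; t \<in> Field r\<rbrakk> \<Longrightarrow> t \<in> underS r s \<or> t = s \<or> s \<in> underS r t"
  using wo unfolding order_on_defs total_on_def underS_def by auto

lemma finite_has_greatest:
  assumes "finite F" "F \<noteq> {}" "F \<subseteq> Field r"
  shows "\<exists>u\<in>F. \<forall>t\<in>F. t = u \<or> t \<in> underS r u"
  using assms
proof (induction rule: finite_ne_induct)
  case (singleton x)
  then show ?case by simp
next
  case (insert x F)
  then obtain u where u: "u \<in> F" "\<forall>t\<in>F. t = u \<or> t \<in> underS r u"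
    by auto
  have "u \<in> Field r" "x \<in> Field r"
    using u(1) insert.prems by auto
  then consider "x \<in> underS r u \<or> x = u" | "u \<in> underS r x"
    using underS_cases by blast
  then show ?case
  proof cases
    case 1
    with u show ?thesis by blast
  next
    case 2
    then have "\<forall>t\<in>insert x F. t = x \<or> t \<in> underS r x"
      using u(2) underS_trans[OF _ 2] 2 by auto
    then show ?thesis by blast
  qed
qed

text \<open>
  Each of the finitely many summands is eventually at most \<open>f s\<close> divided by three times their number.
\<close>
lemma eventual_span_underS_small:
  assumes "y \<in> eventual_span f (underS r s)"
  shows "\<forall>\<^sub>F n in sequentially. 3 * \<bar>y n\<bar> \<le> int (f s n)"
proof -
  obtain F c where F: "finite F" "F \<subseteq> underS r s"
    and y: "\<forall>\<^sub>F n in sequentially. y n = (\<Sum>t\<in>F. c t * int (f t n))"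
    using assms unfolding eventual_span_def by blast
  \<comment> \<open>The summand \<open>1\<close> only keeps \<open>N\<close> positive when \<open>F\<close> is empty.\<close>
  define N where "N = card F + 1"
  have "\<forall>\<^sub>F n in sequentially. \<forall>t\<in>F. (3 * N * nat \<bar>c t\<bar>) * f t n \<le> f s n"
    using F by (intro eventually_ball_finite ballI multiples) auto
  with y show ?thesis
  proof eventually_elim
    case (elim n)
    have "int N * (3 * \<bar>y n\<bar>) \<le> (\<Sum>t\<in>F. int (3 * N * nat \<bar>c t\<bar> * f t n))"
    proof -
      have "\<bar>y n\<bar> \<le> (\<Sum>t\<in>F. \<bar>c t * int (f t n)\<bar>)"
        using elim(1) by (simp add: sum_abs)
      then have "int N * (3 * \<bar>y n\<bar>) \<le> int N * (3 * (\<Sum>t\<in>F. \<bar>c t * int (f t n)\<bar>))"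
        by (intro mult_left_mono) auto
      also have "\<dots> = (\<Sum>t\<in>F. int (3 * N * nat \<bar>c t\<bar> * f t n))"
        by (simp add: sum_distrib_left abs_mult algebra_simps)
      finally show ?thesis .
    qed
    also have "\<dots> \<le> (\<Sum>t\<in>F. int (f s n))"
      using elim(2) by (intro sum_mono) (metis of_nat_mono)
    also have "\<dots> \<le> int N * int (f s n)"
      by (simp add: N_def algebra_simps)
    finally show ?case
      by (simp add: N_def)
  qed
qed

text \<open>
  The greatest generator \<open>f u\<close> with nonzero coefficient is not below \<open>f s\<close>. It contributes at least
  \<open>f u\<close>, and by \<open>eventual_span_underS_small\<close> the other summands take away at most a third of that.
\<close>
lemma eventual_span_not_underS_large:
  assumes x: "x \<in> eventual_span f (Field r)" "x \<notin> eventual_span f (underS r s)"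
    and s: "s \<in> Field r"
  shows "\<forall>\<^sub>F n in sequentially. 2 * int (f s n) \<le> 3 * \<bar>x n\<bar>"
proof -
  obtain F0 c where F0: "finite F0" "F0 \<subseteq> Field r"
    and x0: "\<forall>\<^sub>F n in sequentially. x n = (\<Sum>t\<in>F0. c t * int (f t n))"
    using x unfolding eventual_span_def by blast
  define F where "F = {t \<in> F0. c t \<noteq> 0}"
  have F: "finite F" "F \<subseteq> Field r" and nz: "\<And>t. t \<in> F \<Longrightarrow> c t \<noteq> 0"
    using F0 by (auto simp: F_def)
  have "(\<Sum>t\<in>F0. c t * int (f t n)) = (\<Sum>t\<in>F. c t * int (f t n))" for n
    using F0 by (intro sum.mono_neutral_right) (auto simp: F_def)
  with x0 have xF: "\<forall>\<^sub>F n in sequentially. x n = (\<Sum>t\<in>F. c t * int (f t n))"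
    by simp
  have "\<not> F \<subseteq> underS r s"
    using x(2) xF F unfolding eventual_span_def by blast
  then obtain v where v: "v \<in> F" "v \<notin> underS r s"
    by blast
  obtain u where u: "u \<in> F" "\<forall>t\<in>F. t = u \<or> t \<in> underS r u"
    using finite_has_greatest[OF F(1) _ F(2)] v by blast
  have "u \<notin> underS r s"
    using u(2) v underS_trans[of v u s] by auto
  then have su: "s = u \<or> s \<in> underS r u"
    using underS_cases[of s u] s u F by blast
  define y where "y n = (\<Sum>t\<in>F - {u}. c t * int (f t n))" for n
  have "y \<in> eventual_span f (underS r u)"
    unfolding eventual_span_def y_def using F u by (intro CollectI exI[of _ "F - {u}"] exI[of _ c]) auto
  then have "\<forall>\<^sub>F n in sequentially. 3 * \<bar>y n\<bar> \<le> int (f u n)"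
    by (rule eventual_span_underS_small)
  moreover have "\<forall>\<^sub>F n in sequentially. f s n \<le> f u n"
    using su multiples[of s u 1] by auto
  ultimately show ?thesis
    using xF
  proof eventually_elim
    case (elim n)
    have "x n = c u * int (f u n) + y n"
      using elim(3) u(1) F(1) by (simp add: y_def sum.remove)
    moreover have "1 \<le> \<bar>c u\<bar>"
      using nz[OF u(1)] by linarith
    then have "int (f u n) \<le> \<bar>c u * int (f u n)\<bar>"
      by (simp add: abs_mult mult_le_cancel_right1)
    ultimately show ?case
      using elim(1,2) by linarith
  qed
qed

lemma inj_on_generators: "inj_on (\<lambda>s n. int (f s n)) (Field r)"
proof (rule inj_onI)
  have neq: "(\<lambda>n. int (f s n)) \<noteq> (\<lambda>n. int (f t n))" if st: "s \<in> underS r t" "s \<in> Field r" for s t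
  proof
    assume "(\<lambda>n. int (f s n)) = (\<lambda>n. int (f t n))"
    then have eq: "f s n = f t n" for n
      by (simp add: fun_eq_iff)
    have "\<exists>n. 2 * f s n \<le> f t n"
      using multiples[OF st(1), of 2] eventually_happens by fastforce
    then obtain n where "2 * f s n \<le> f t n" ..
    with eq[of n] positive[OF st(2), of n] show False
      by simp
  qed
  show "s = t" if "s \<in> Field r" "t \<in> Field r" "(\<lambda>n. int (f s n)) = (\<lambda>n. int (f t n))" for s t
    using underS_cases[OF that(1,2)] neq[of s t] neq[of t s] that by auto
qed

end

section \<open>Countable sets that are relatively \<open>G\<^sub>\<delta>\<close>\<close>

lemma openin_cylinder: "openin Z_omega_topology {x. \<forall>i\<le>N. x i = c i}"
proof -
  let ?V = "\<lambda>i. if i \<le> N then {c i} else UNIV"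
  have "openin Z_omega_topology (Pi\<^sub>E UNIV ?V)"
    unfolding openin_PiE_gen by (auto intro: finite_subset[of _ "{..N}"])
  moreover have "Pi\<^sub>E UNIV ?V = {x. \<forall>i\<le>N. x i = c i}"
    by (auto simp: PiE_UNIV_domain Pi_iff split: if_splits)
  ultimately show ?thesis by simp
qed

lemma second_countable_Z_omega: "second_countable Z_omega_topology"
proof -
  define cyl where "cyl l = {x :: nat \<Rightarrow> int. \<forall>i<length l. x i = l ! i}" for l
  have open_cyl: "openin Z_omega_topology (cyl l)" for l
  proof (cases l rule: rev_cases)
    case Nil
    then show ?thesis
      using openin_topspace[of Z_omega_topology] by (simp add: cyl_def PiE_UNIV_domain)
  next
    case (snoc l' a)
    then have "cyl l = {x. \<forall>i\<le>length l'. x i = l ! i}"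
      by (auto simp: cyl_def less_Suc_eq_le)
    then show ?thesis
      by (simp add: openin_cylinder)
  qed
  have base: "\<exists>V\<in>range cyl. x \<in> V \<and> V \<subseteq> U" if U: "openin Z_omega_topology U" "x \<in> U" for U x
  proof -
    obtain V where V: "finite {i. V i \<noteq> UNIV}" "x \<in> Pi\<^sub>E UNIV V" "Pi\<^sub>E UNIV V \<subseteq> U"
      using U unfolding openin_product_topology_alt by auto
    obtain N where N: "\<And>i. V i \<noteq> UNIV \<Longrightarrow> i < N"
      using V(1) unfolding finite_nat_set_iff_bounded by blast
    have "y \<in> Pi\<^sub>E UNIV V" if "y \<in> cyl (map x [0..<N])" for y
    proof -
      have "y i = x i" if "i < N" for i
        using \<open>y \<in> _\<close> that by (simp add: cyl_def)
      then show ?thesis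
        using V(2) N unfolding PiE_UNIV_domain Pi_iff by (metis UNIV_I)
    qed
    then have "cyl (map x [0..<N]) \<subseteq> U"
      using V(3) by blast
    moreover have "x \<in> cyl (map x [0..<N])"
      by (simp add: cyl_def)
    ultimately show ?thesis
      by blast
  qed
  have "countable (range cyl)"
    by simp
  with open_cyl base show ?thesis
    unfolding second_countable_def by (intro exI[of _ "range cyl"]) auto
qed

lemma metrizable_Z_omega: "metrizable_space Z_omega_topology"
  by (simp add: metrizable_space_product_topology)

text \<open>
  The \<open>G\<^sub>\<delta>\<close> set is the intersection over \<open>k\<close> of the open sets of points that agree with some \<open>c n\<close> up
  to \<open>h n + k\<close>. A point outside \<open>range c\<close> whose first differences exceed \<open>h\<close> at finitely many
  \<open>n\<close> only is excluded once \<open>k\<close> exceeds the differences at these \<open>n\<close>.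
\<close>
lemma gdelta_in_if_first_differences_bounded:
  fixes c :: "nat \<Rightarrow> nat \<Rightarrow> int"
  assumes sub: "range c \<subseteq> X"
    and differ: "\<And>x. x \<in> X - range c \<Longrightarrow> \<forall>\<^sub>F n in sequentially. \<exists>i\<le>h n. x i \<noteq> c n i"
  shows "gdelta_in (subtopology Z_omega_topology X) (range c)"
proof -
  define G where "G k = (\<Union>n. {x. \<forall>i\<le>h n + k. x i = c n i})" for k
  have gdelta: "gdelta_in Z_omega_topology (\<Inter>(range G))"
    by (intro gdelta_in_Inter) (auto simp: G_def intro!: open_imp_gdelta_in openin_cylinder)
  have "x \<in> range c" if x: "x \<in> X" "\<And>k. x \<in> G k" for x
  proof (rule ccontr)
    assume "x \<notin> range c"
    then obtain N where N: "\<And>n. n \<ge> N \<Longrightarrow> \<exists>i\<le>h n. x i \<noteq> c n i"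
      using differ[of x] x(1) unfolding eventually_sequentially by auto
    have "\<forall>n. \<exists>i. x i \<noteq> c n i"
      using \<open>x \<notin> range c\<close> by (metis rangeI ext)
    then obtain d where d: "\<And>n. x (d n) \<noteq> c n (d n)"
      by metis
    obtain n where n: "x i = c n i" if "i \<le> h n + (\<Sum>m<N. d m)" for i
      using x(2)[of "\<Sum>m<N. d m"] unfolding G_def by blast
    show False
    proof (cases "n < N")
      case True
      then have "d n \<le> (\<Sum>m<N. d m)"
        by (intro member_le_sum) auto
      then show False using n[of "d n"] d[of n] by simp
    next
      case False
      then obtain i where "i \<le> h n" "x i \<noteq> c n i"
        using N[of n] by auto
      then show False using n[of i] by simp
    qed
  qed
  moreover have "c n \<in> G k" for n k
    by (auto simp: G_def)
  then have "range c \<subseteq> (\<Inter>(range G))"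
    by auto
  ultimately have "range c = (\<Inter>(range G)) \<inter> X"
    using sub by auto
  with gdelta show ?thesis
    unfolding gdelta_in_subtopology by blast
qed

theorem theorem3p3:
  shows "\<exists>X :: (nat \<Rightarrow> int) set.
           subgroup X Z_omega_group \<and>
           Z_omega_topology closure_of X = topspace Z_omega_topology \<and>
           |X| =o \<bb> \<and>
           lambda_set (subtopology Z_omega_topology X)"
proof -
  obtain S where unb: "\<not> bounded_star S" and S: "|S| = \<bb>"
    using bounding_number_attained by metis
  have inf: "infinite S"
    using unb bounded_star_if_countable countable_finite by blast
  obtain f where rapid: "rapidly_increasing |S| f" and above: "\<And>s n. s \<in> S \<Longrightarrow> s n \<le> f s n"
    using rapidly_increasing_above[OF S] by blast
  interpret rapidly_increasing "|S|" f
    by (rule rapid)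
  have Field: "Field |S| = S"
    by (rule Field_card_of)
  define X where "X = eventual_span f S"
  have "|X| \<le>o |S|"
    unfolding X_def by (rule card_eventual_span[OF inf])
  moreover have "|S| \<le>o |X|"
    using inj_on_generators generator_in_eventual_span[of _ S f]
    by (intro card_of_ordLeqI[of "\<lambda>s n. int (f s n)"]) (auto simp: Field X_def)
  ultimately have card: "|X| =o \<bb>"
    by (simp add: ordIso_iff_ordLeq S)
  have "gdelta_in (subtopology Z_omega_topology X) C" if C: "C \<subseteq> X" "countable C" for C
  proof (cases "C = {}")
    case True
    then show ?thesis by (simp add: open_imp_gdelta_in)
  next
    case False
    define c where "c = from_nat_into C"
    have c: "range c = C"
      using False C by (simp add: c_def range_from_nat_into)
    have "\<exists>F. finite F \<and> F \<subseteq> S \<and> c n \<in> eventual_span f F" for n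
    proof -
      have "c n \<in> eventual_span f S"
        using c C by (auto simp: X_def)
      then show ?thesis
        unfolding eventual_span_def by blast
    qed
    then obtain F where F: "\<And>n. finite (F n)" "\<And>n. F n \<subseteq> S" "\<And>n. c n \<in> eventual_span f (F n)"
      by metis
    define T where "T = (\<Union>n. F n)"
    have "countable T" "T \<subseteq> S"
      using F by (auto simp: T_def countable_finite)
    \<comment> \<open>The countably many generators that occur in \<open>C\<close> are not cofinal, since \<open>S\<close> is unbounded.\<close>
    have "\<exists>s\<in>S. T \<subseteq> underS |S| s"
    proof (rule ccontr)
      assume cofinal: "\<not> ?thesis"
      have "bounded_star (f ` T)"
        using \<open>countable T\<close> by (intro bounded_star_if_countable) auto
      then obtain g where g: "\<And>t. t \<in> T \<Longrightarrow> f t \<le>\<^sup>* g"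
        unfolding bounded_star_def by blast
      have "s \<le>\<^sup>* g" if s: "s \<in> S" for s
      proof -
        obtain t where t: "t \<in> T" "t \<notin> underS |S| s"
          using cofinal s by blast
        then have "t = s \<or> s \<in> underS |S| t"
          using underS_cases[of s t] s \<open>T \<subseteq> S\<close> by (auto simp: Field)
        then have "\<forall>\<^sub>F n in sequentially. f s n \<le> f t n"
          using multiples[of s t 1] by auto
        with g[OF t(1)] show ?thesis
          unfolding le_star_eventually
          by eventually_elim (meson above[OF s] le_trans)
      qed
      then show False
        using unb unfolding bounded_star_def by blast
    qed
    then obtain s where s: "s \<in> S" "T \<subseteq> underS |S| s"
      by blast
    define Y where "Y = eventual_span f (underS |S| s)"
    have cY: "c n \<in> Y" for n
      using F(3)[of n] eventual_span_mono[of "F n" "underS |S| s" f] s(2) by (auto simp: Y_def T_def)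
    define d where "d x n = (LEAST i. x i \<noteq> c n i)" for x n
    have d: "x (d x n) \<noteq> c n (d x n)" if "x \<notin> C" for x n
    proof -
      have "\<exists>i. x i \<noteq> c n i"
        using that c by (metis rangeI ext)
      then show ?thesis
        unfolding d_def by (rule LeastI_ex)
    qed
    \<comment> \<open>\<open>Y\<close> is countable or has the size of a proper initial segment of \<open>S\<close>.\<close>
    have "bounded_star (d ` (Y - C))"
    proof (cases "finite (underS |S| s)")
      case True
      then have "countable Y"
        unfolding Y_def by (intro countable_eventual_span countable_finite)
      then show ?thesis
        by (intro bounded_star_if_countable) auto
    next
      case False
      have "|d ` (Y - C)| \<le>o |Y|"
        using card_of_image card_of_mono1[of "Y - C" Y] ordLeq_transitive by blast
      also have "|Y| \<le>o |underS |S| s|"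
        unfolding Y_def by (rule card_eventual_span[OF False])
      also have "|underS |S| s| <o |S|"
        using s by (intro card_of_underS) (auto simp: Field)
      finally show ?thesis
        unfolding S by (rule bounded_star_if_card_less)
    qed
    then obtain h0 where h0: "\<And>x. x \<in> Y \<Longrightarrow> x \<notin> C \<Longrightarrow> \<forall>\<^sub>F n in sequentially. d x n \<le> h0 n"
      unfolding bounded_star_def le_star_eventually by blast
    have "\<exists>k. \<forall>i\<ge>k. 3 * \<bar>c n i\<bar> \<le> int (f s i)" for n
      using eventual_span_underS_small cY unfolding Y_def eventually_sequentially by blast
    then obtain k where k: "\<And>n i. i \<ge> k n \<Longrightarrow> 3 * \<bar>c n i\<bar> \<le> int (f s i)"
      by metis
    \<comment> \<open>\<open>h0\<close> serves the points of \<open>Y\<close>. For a point outside \<open>Y\<close> that is large from \<open>m\<close> on, the place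
      \<open>max (k n) n\<close> separates it from \<open>c n\<close> whenever \<open>n \<ge> m\<close>.\<close>
    define h where "h n = max (h0 n) (max (k n) n)" for n
    have "\<forall>\<^sub>F n in sequentially. \<exists>i\<le>h n. x i \<noteq> c n i" if x: "x \<in> X" "x \<notin> C" for x
    proof (cases "x \<in> Y")
      case True
      then have "\<forall>\<^sub>F n in sequentially. d x n \<le> h0 n"
        using h0 x by blast
      then show ?thesis
        by eventually_elim (use d[OF x(2)] in \<open>auto simp: h_def le_max_iff_disj\<close>)
    next
      case False
      then obtain m where m: "\<And>i. i \<ge> m \<Longrightarrow> 2 * int (f s i) \<le> 3 * \<bar>x i\<bar>"
        using eventual_span_not_underS_large[of x s] x s
        unfolding X_def Y_def Field eventually_sequentially by blast
      have "x (max (k n) n) \<noteq> c n (max (k n) n)" if "n \<ge> m" for n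
      proof -
        have "2 * int (f s (max (k n) n)) \<le> 3 * \<bar>x (max (k n) n)\<bar>"
          using that by (intro m) simp
        moreover have "3 * \<bar>c n (max (k n) n)\<bar> \<le> int (f s (max (k n) n))"
          by (intro k) simp
        moreover have "1 \<le> f s (max (k n) n)"
          using s(1) by (intro positive) (simp add: Field)
        ultimately show ?thesis
          by auto
      qed
      then show ?thesis
        unfolding eventually_sequentially h_def by (metis max.cobounded2)
    qed
    then have "gdelta_in (subtopology Z_omega_topology X) (range c)"
      using C c by (intro gdelta_in_if_first_differences_bounded[where h = h]) auto
    then show ?thesis
      by (simp add: c)
  qed
  then have "lambda_set (subtopology Z_omega_topology X)"
    unfolding lambda_set_def
    using metrizable_space_subtopology[OF metrizable_Z_omega]
      second_countable_imp_separable_space[OF second_countable_subtopology[OF second_countable_Z_omega]]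
    by auto
  moreover have "subgroup X Z_omega_group" "Z_omega_topology closure_of X = topspace Z_omega_topology"
    unfolding X_def by (rule subgroup_eventual_span dense_eventual_span)+
  ultimately show ?thesis
    using card by blast
qed

end
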